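(* Let $h(x)=l(Ax)$ for some continuous strictly convex function $l:\mathbb{R}^m\to\mathbb{R}$ and $A\in\mathbb{R}^{m\times n}$, let $g:\mathbb{R}^n\to\mathbb{R}$ be a continuous convex function, let $\alpha\in(0,1)$, and let $D\subseteq\mathbb{R}^n$ be a closed convex set. Let $C=\{x: g(x)\le 0\}$. Suppose in addition that (i) there exists $x_0\in D$ with $g(x_0)<0$; (ii) $\inf_{x\in D}h(x)<\inf_{x\in C\cap D}h(x)$; (iii) for any $\lambda>0$, the function $h(x)+\lambda g(x)+\delta_D(x)$ is a KL function with an exponent of $\alpha$. Then $f(x)=h(x)+\delta_C(x)+\delta_D(x)$ has the KL property at any $\bar x\in C\cap D$, with an exponent of $\alpha$.
   Context: $\delta_S$ denotes the indicator function of a set $S$ ($0$ on $S$, $+\infty$ elsewhere). For convex $f$, $\partial f$ is the usual convex subdifferential. $\mathrm{dom}\,\partial f=\{x:\partial f(x)\ne\emptyset\}$. A proper closed (i.e. lower semicontinuous) function $f$ has the KL property at $\bar x\in\mathrm{dom}\,\partial f$ with an exponent of $\alpha\in[0,1)$ if there exist $c,\epsilon>0$ and $\nu\in(0,\infty]$ such that $\mathrm{dist}(0,\partial f(x))\ge c\,(f(x)-f(\bar x))^\alpha$ whenever $\|x-\bar x\|\le\epsilon$ and $f(\bar x)<f(x)<f(\bar x)+\nu$ (with $\mathrm{dist}(0,\emptyset)=+\infty$). It is a KL function with an exponent of $\alpha$ if it has the KL property with exponent $\alpha$ at every $\bar x\in\mathrm{dom}\,\partial f$. *)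

theory Defs
  imports "HOL-Analysis.Analysis"
begin

definition delta :: "'a set \<Rightarrow> 'a \<Rightarrow> ereal" where
  "delta S x = (if x \<in> S then 0 else \<infinity>)"

definition strictly_convex_on :: "'a::real_vector set \<Rightarrow> ('a \<Rightarrow> real) \<Rightarrow> bool" where
  "strictly_convex_on S f \<longleftrightarrow> convex S \<and>
     (\<forall>x\<in>S. \<forall>y\<in>S. \<forall>u>0. \<forall>v>0. x \<noteq> y \<longrightarrow> u + v = 1 \<longrightarrow>
        f (u *\<^sub>R x + v *\<^sub>R y) < u * f x + v * f y)"

definition proper_fun :: "('a \<Rightarrow> ereal) \<Rightarrow> bool" where
  "proper_fun f \<longleftrightarrow> (\<forall>x. f x \<noteq> -\<infinity>) \<and> (\<exists>x. f x \<noteq> \<infinity>)"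

definition lower_semicontinuous :: "('a::topological_space \<Rightarrow> ereal) \<Rightarrow> bool" where
  "lower_semicontinuous f \<longleftrightarrow> (\<forall>x. f x \<le> Liminf (at x) f)"

text \<open>The convex subdifferential; it is empty at every point where \<open>f\<close> is not finite.\<close>

definition subdifferential :: "('a::real_inner \<Rightarrow> ereal) \<Rightarrow> 'a \<Rightarrow> 'a set" where
  "subdifferential f x =
     {v. \<bar>f x\<bar> \<noteq> \<infinity> \<and> (\<forall>y. f x + ereal (v \<bullet> (y - x)) \<le> f y)}"

definition dom_subdifferential :: "('a::real_inner \<Rightarrow> ereal) \<Rightarrow> 'a set" where
  "dom_subdifferential f = {x. subdifferential f x \<noteq> {}}"

text \<open>Extended-valued, so that the distance to the empty set is \<open>\<infinity>\<close>
  (whereas \<^const>\<open>infdist\<close> would give \<open>0\<close>).\<close>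

definition edist_set :: "'a::metric_space \<Rightarrow> 'a set \<Rightarrow> ereal" where
  "edist_set x S = (INF s\<in>S. ereal (dist x s))"

text \<open>The values \<open>f x\<close> and \<open>f xbar\<close> compared below are finite: \<open>f xbar\<close> because
  \<open>xbar\<close> lies in the domain of the subdifferential, \<open>f x\<close> because
  \<open>f xbar < f x < f xbar + \<nu>\<close>. The base of the power is positive, so \<open>\<alpha> = 0\<close> gives the
  value \<open>1\<close>.\<close>

definition KL_property :: "('a::real_inner \<Rightarrow> ereal) \<Rightarrow> 'a \<Rightarrow> real \<Rightarrow> bool" where
  "KL_property f xbar \<alpha> \<longleftrightarrow>
     proper_fun f \<and> lower_semicontinuous f \<and> xbar \<in> dom_subdifferential f \<and>
     0 \<le> \<alpha> \<and> \<alpha> < 1 \<and>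
     (\<exists>c>0. \<exists>\<epsilon>>0. \<exists>\<nu>>(0::ereal). \<forall>x.
        norm (x - xbar) \<le> \<epsilon> \<longrightarrow> f xbar < f x \<longrightarrow> f x < f xbar + \<nu> \<longrightarrow>
        ereal (c * (real_of_ereal (f x) - real_of_ereal (f xbar)) powr \<alpha>)
          \<le> edist_set 0 (subdifferential f x))"

definition KL_function :: "('a::real_inner \<Rightarrow> ereal) \<Rightarrow> real \<Rightarrow> bool" where
  "KL_function f \<alpha> \<longleftrightarrow>
     proper_fun f \<and> lower_semicontinuous f \<and> 0 \<le> \<alpha> \<and> \<alpha> < 1 \<and>
     (\<forall>xbar \<in> dom_subdifferential f. KL_property f xbar \<alpha>)"

end

theory Submission
  imports Defs
begin

text \<open>
  The function \<open>f\<close> is \<open>h\<close> restricted to the convex set \<open>C \<inter> D\<close>. At a point that does not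
  minimise \<open>f\<close>, the subgradients at nearby points of larger value are bounded away from zero, so
  every exponent works. The substance lies at a minimiser \<open>xbar\<close>, where the KL inequality is
  obtained by passing through a growth condition and a Lagrangian.

  By the Slater condition there is a multiplier \<open>\<mu> \<ge> 0\<close> for which \<open>xbar\<close> minimises
  \<open>F = h + \<mu> g\<close> over \<open>D\<close>. Since the constraint changes the infimum of \<open>h\<close>, the multiplier is
  positive, and so \<open>F\<close> is a KL function by assumption and \<open>g xbar = 0\<close>. For convex functions the
  KL inequality of exponent \<open>\<alpha>\<close> at a minimiser yields the growth condition
  \<open>dist x (argmin F) \<le> \<kappa> (F x - min F) powr (1 - \<alpha>)\<close> near \<open>xbar\<close>
  (\<open>growth_of_KL_inequality\<close>), and a growth condition of this form for \<open>f\<close> yields the KL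
  inequality for \<open>f\<close> (\<open>KL_inequality_of_growth\<close>).

  Two comparisons carry the growth condition from \<open>F\<close> to \<open>f\<close>. First, \<open>F \<le> h\<close> on \<open>C\<close>, because
  \<open>g \<le> 0\<close> there, and the two functions agree at \<open>xbar\<close>. Second, every minimiser of \<open>F\<close> over \<open>D\<close>
  minimises \<open>f\<close>: as \<open>l\<close> is strictly convex, \<open>A *v y\<close> is the same for all minimisers \<open>y\<close> of
  \<open>F\<close>, so that \<open>h y = h xbar\<close>, and then \<open>\<mu> > 0\<close> forces \<open>g y = g xbar = 0\<close>
  (\<open>strictly_convex_comp_minimisers\<close>).
\<close>

section \<open>Functions restricted to a set\<close>

definition subgradient_on :: "'a::real_inner set \<Rightarrow> ('a \<Rightarrow> real) \<Rightarrow> 'a \<Rightarrow> 'a \<Rightarrow> bool" where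
  "subgradient_on S p x v \<longleftrightarrow> (\<forall>y\<in>S. p x + v \<bullet> (y - x) \<le> p y)"

text \<open>The quantitative part of \<^const>\<open>KL_property\<close> for \<open>p + \<delta>\<^sub>S\<close>, written without extended reals:
  the distance to the subdifferential becomes a bound on every subgradient, which is vacuous where
  there is none.\<close>

definition KL_inequality_on :: "'a::real_inner set \<Rightarrow> ('a \<Rightarrow> real) \<Rightarrow> 'a \<Rightarrow> real \<Rightarrow> bool" where
  "KL_inequality_on S p xbar \<alpha> \<longleftrightarrow>
     (\<exists>c>0. \<exists>\<epsilon>>0. \<exists>\<nu>>0. \<forall>x\<in>S. \<forall>v.
        norm (x - xbar) \<le> \<epsilon> \<longrightarrow> p xbar < p x \<longrightarrow> p x < p xbar + \<nu> \<longrightarrow> subgradient_on S p x v \<longrightarrow>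
        c * (p x - p xbar) powr \<alpha> \<le> norm v)"

lemma KL_inequality_onI:
  assumes "c > 0" "\<epsilon> > 0" "\<nu> > 0"
    and "\<And>x v. x \<in> S \<Longrightarrow> norm (x - xbar) \<le> \<epsilon> \<Longrightarrow> p xbar < p x \<Longrightarrow> p x < p xbar + \<nu> \<Longrightarrow>
        subgradient_on S p x v \<Longrightarrow> c * (p x - p xbar) powr \<alpha> \<le> norm v"
  shows "KL_inequality_on S p xbar \<alpha>"
  using assms unfolding KL_inequality_on_def by blast

lemma subdifferential_add_delta:
  "subdifferential (\<lambda>x. ereal (p x) + delta S x) x = {v. x \<in> S \<and> subgradient_on S p x v}"
  by (auto simp: subdifferential_def subgradient_on_def delta_def)

lemma le_edist_set_0_iff: "ereal r \<le> edist_set 0 V \<longleftrightarrow> (\<forall>v\<in>V. r \<le> norm v)"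
  by (simp add: edist_set_def le_INF_iff)

lemma lower_semicontinuous_add_delta:
  fixes p :: "'a::topological_space \<Rightarrow> real"
  assumes "continuous_on UNIV p" "closed S"
  shows "lower_semicontinuous (\<lambda>x. ereal (p x) + delta S x)"
  unfolding lower_semicontinuous_def le_Liminf_iff
proof (intro allI impI)
  fix x and y :: ereal
  assume y: "y < ereal (p x) + delta S x"
  show "\<forall>\<^sub>F z in at x. y < ereal (p z) + delta S z"
  proof (cases "x \<in> S")
    case True
    have "continuous_on UNIV (\<lambda>x. ereal (p x))"
      using assms(1) by (intro continuous_intros)
    then have "((\<lambda>z. ereal (p z)) \<longlongrightarrow> ereal (p x)) (at x)"
      by (simp add: continuous_on_def)
    moreover have "y < ereal (p x)"
      using y True by (simp add: delta_def)
    ultimately have "\<forall>\<^sub>F z in at x. y < ereal (p z)"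
      by (rule order_tendstoD(1))
    then show ?thesis
      by eventually_elim (auto simp: delta_def)
  next
    case False
    then have "\<forall>\<^sub>F z in nhds x. z \<in> - S"
      using assms(2) by (intro eventually_nhds_in_open) auto
    then have "\<forall>\<^sub>F z in at x. z \<in> - S"
      by (simp add: eventually_at_filter eventually_mono)
    moreover have "y < \<infinity>"
      using y by (cases y) auto
    ultimately show ?thesis
      by (auto elim!: eventually_mono simp: delta_def)
  qed
qed

lemma KL_inequality_on_of_KL_property:
  assumes "KL_property (\<lambda>x. ereal (p x) + delta S x) xbar \<alpha>" and "xbar \<in> S"
  shows "KL_inequality_on S p xbar \<alpha>"
proof -
  obtain c \<epsilon> and \<nu>' :: ereal where c: "c > 0" "\<epsilon> > 0" "\<nu>' > 0"
    and KL: "\<And>x. norm (x - xbar) \<le> \<epsilon> \<Longrightarrow>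
        ereal (p xbar) + delta S xbar < ereal (p x) + delta S x \<Longrightarrow>
        ereal (p x) + delta S x < ereal (p xbar) + delta S xbar + \<nu>' \<Longrightarrow>
        ereal (c * (real_of_ereal (ereal (p x) + delta S x)
           - real_of_ereal (ereal (p xbar) + delta S xbar)) powr \<alpha>)
          \<le> edist_set 0 (subdifferential (\<lambda>x. ereal (p x) + delta S x) x)"
    using assms(1) unfolding KL_property_def by blast
  obtain \<nu> where \<nu>: "0 < ereal \<nu>" "ereal \<nu> < \<nu>'"
    using ereal_dense2[OF \<open>\<nu>' > 0\<close>] by auto
  have "c * (p x - p xbar) powr \<alpha> \<le> norm v"
    if x: "x \<in> S" "norm (x - xbar) \<le> \<epsilon>" "p xbar < p x" "p x < p xbar + \<nu>" "subgradient_on S p x v"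
    for x v
  proof -
    have "ereal (p x) < ereal (p xbar) + ereal \<nu>"
      using x by simp
    also have "\<dots> \<le> ereal (p xbar) + \<nu>'"
      using \<nu> by (intro add_left_mono) auto
    finally have "ereal (p x) < ereal (p xbar) + \<nu>'" .
    then show ?thesis
      using KL[of x] x assms(2) unfolding le_edist_set_0_iff subdifferential_add_delta
      by (simp add: delta_def)
  qed
  then show ?thesis
    using c \<nu> by (intro KL_inequality_onI[of c \<epsilon> \<nu>]) auto
qed

lemma KL_property_of_KL_inequality_on:
  assumes "continuous_on UNIV p" "closed S" "xbar \<in> S" "subgradient_on S p xbar v"
    and "0 \<le> \<alpha>" "\<alpha> < 1" and KL: "KL_inequality_on S p xbar \<alpha>"
  shows "KL_property (\<lambda>x. ereal (p x) + delta S x) xbar \<alpha>"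
proof -
  let ?f = "\<lambda>x. ereal (p x) + delta S x"
  have f: "?f x = (if x \<in> S then ereal (p x) else \<infinity>)" for x
    by (simp add: delta_def)
  have "proper_fun ?f"
    using assms(3) unfolding proper_fun_def f by auto
  moreover have "lower_semicontinuous ?f"
    using assms by (intro lower_semicontinuous_add_delta)
  moreover have "xbar \<in> dom_subdifferential ?f"
    using assms by (auto simp: dom_subdifferential_def subdifferential_add_delta)
  moreover obtain c \<epsilon> \<nu> where c: "c > 0" "\<epsilon> > 0" "\<nu> > 0"
    and *: "\<And>x v. x \<in> S \<Longrightarrow> norm (x - xbar) \<le> \<epsilon> \<Longrightarrow> p xbar < p x \<Longrightarrow> p x < p xbar + \<nu> \<Longrightarrow>
        subgradient_on S p x v \<Longrightarrow> c * (p x - p xbar) powr \<alpha> \<le> norm v"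
    using KL unfolding KL_inequality_on_def by blast
  have "ereal \<nu> > 0"
    using c by simp
  have "ereal (c * (real_of_ereal (?f x) - real_of_ereal (?f xbar)) powr \<alpha>)
          \<le> edist_set 0 (subdifferential ?f x)"
    if x: "norm (x - xbar) \<le> \<epsilon>" "?f xbar < ?f x" "?f x < ?f xbar + ereal \<nu>" for x
  proof -
    have "x \<in> S"
      using x(3) assms(3) by (auto simp: f split: if_splits)
    then show ?thesis
      using x assms(3) * unfolding le_edist_set_0_iff subdifferential_add_delta
      by (simp add: delta_def)
  qed
  then have "\<exists>c>0. \<exists>\<epsilon>>0. \<exists>\<nu>>(0::ereal). \<forall>x.
        norm (x - xbar) \<le> \<epsilon> \<longrightarrow> ?f xbar < ?f x \<longrightarrow> ?f x < ?f xbar + \<nu> \<longrightarrow>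
        ereal (c * (real_of_ereal (?f x) - real_of_ereal (?f xbar)) powr \<alpha>)
          \<le> edist_set 0 (subdifferential ?f x)"
    using c(1,2) \<open>ereal \<nu> > 0\<close> by blast
  ultimately show ?thesis
    using assms(5,6) unfolding KL_property_def by blast
qed

section \<open>Separation, subgradients and multipliers\<close>

text \<open>The graph of an affine function between \<open>q\<close> and \<open>p\<close> is a hyperplane separating the
  epigraph of \<open>p\<close> from the open hypograph of \<open>q\<close>. It is not vertical, because the hypograph
  projects onto the whole space.\<close>

lemma affine_between_concave_and_convex:
  fixes p q :: "'a::euclidean_space \<Rightarrow> real"
  assumes p: "convex_on S p" and q: "concave_on UNIV q" and "S \<noteq> {}"
    and le: "\<And>x. x \<in> S \<Longrightarrow> q x \<le> p x"
  obtains a b where "\<And>x. q x \<le> a \<bullet> x + b" "\<And>x. x \<in> S \<Longrightarrow> a \<bullet> x + b \<le> p x"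
proof -
  define E where "E = epigraph S p"
  define H where "H = {(x, r). r < q x}"
  have "convex E"
    using p by (simp add: E_def convex_epigraph)
  moreover have "convex H"
  proof (rule convexI, clarsimp simp: H_def)
    fix x r y s and u v :: real
    assume "r < q x" "s < q y" "0 \<le> u" "0 \<le> v" "u + v = 1"
    moreover have "u * r + v * s < u * q x + v * q y"
    proof (cases "u = 0")
      case False
      with calculation have "u * r < u * q x" "v * s \<le> v * q y"
        by (auto intro: mult_left_mono)
      then show ?thesis
        by linarith
    qed (use calculation in simp)
    moreover have "u * q x + v * q y \<le> q (u *\<^sub>R x + v *\<^sub>R y)"
      using q calculation by (simp add: concave_on_iff)
    ultimately show "u * r + v * s < q (u *\<^sub>R x + v *\<^sub>R y)"
      by linarith
  qed
  moreover have "E \<noteq> {}"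
    using \<open>S \<noteq> {}\<close> by (auto simp: E_def epigraph_def)
  moreover have "(0, q 0 - 1) \<in> H"
    by (simp add: H_def)
  moreover have "E \<inter> H = {}"
    using le by (fastforce simp: E_def H_def epigraph_def)
  ultimately obtain w \<gamma> where w: "w \<noteq> 0" "\<And>z. z \<in> E \<Longrightarrow> w \<bullet> z \<le> \<gamma>" "\<And>z. z \<in> H \<Longrightarrow> w \<bullet> z \<ge> \<gamma>"
    using separating_hyperplane_sets[of E H] by blast
  obtain a \<beta> where ab: "w = (a, \<beta>)"
    by fastforce
  have E: "a \<bullet> x + \<beta> * r \<le> \<gamma>" if "x \<in> S" "p x \<le> r" for x r
    using w(2)[of "(x, r)"] that by (simp add: E_def epigraph_def ab)
  have H: "a \<bullet> x + \<beta> * r \<ge> \<gamma>" if "r < q x" for x r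
    using w(3)[of "(x, r)"] that by (simp add: H_def ab)
  obtain x0 where x0: "x0 \<in> S"
    using \<open>S \<noteq> {}\<close> by blast
  have "\<beta> \<le> 0"
  proof (rule ccontr)
    assume "\<not> \<beta> \<le> 0"
    \<comment> \<open>far enough up in the epigraph the functional would exceed \<open>\<gamma>\<close>\<close>
    define r where "r = max (p x0) ((\<gamma> - a \<bullet> x0) / \<beta> + 1)"
    have "\<beta> * ((\<gamma> - a \<bullet> x0) / \<beta> + 1) \<le> \<beta> * r"
      using \<open>\<not> \<beta> \<le> 0\<close> by (intro mult_left_mono) (auto simp: r_def)
    moreover have "\<beta> * ((\<gamma> - a \<bullet> x0) / \<beta> + 1) = \<gamma> - a \<bullet> x0 + \<beta>"
      using \<open>\<not> \<beta> \<le> 0\<close> by (simp add: field_simps)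
    moreover have "a \<bullet> x0 + \<beta> * r \<le> \<gamma>"
      using E[OF x0] by (simp add: r_def)
    ultimately show False
      using \<open>\<not> \<beta> \<le> 0\<close> by linarith
  qed
  moreover have "\<beta> \<noteq> 0"
  proof
    assume "\<beta> = 0"
    then have "a \<noteq> 0"
      using w(1) by (simp add: ab zero_prod_def)
    \<comment> \<open>a nonzero linear functional takes the value \<open>\<gamma> - 1\<close> somewhere\<close>
    define z where "z = ((\<gamma> - 1) / (a \<bullet> a)) *\<^sub>R a"
    have "a \<bullet> z = \<gamma> - 1"
      using \<open>a \<noteq> 0\<close> by (simp add: z_def)
    then show False
      using H[of "q z - 1" z] \<open>\<beta> = 0\<close> by simp
  qed
  ultimately have \<beta>: "\<beta> < 0"
    by simp
  show thesis
  proof (rule that[of "(- 1 / \<beta>) *\<^sub>R a" "\<gamma> / \<beta>"])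
    fix x
    show "q x \<le> ((- 1 / \<beta>) *\<^sub>R a) \<bullet> x + \<gamma> / \<beta>"
    proof (rule dense_le)
      fix r assume "r < q x"
      from H[OF this] \<beta> show "r \<le> ((- 1 / \<beta>) *\<^sub>R a) \<bullet> x + \<gamma> / \<beta>"
        by (simp add: field_simps)
    qed
  next
    fix x assume "x \<in> S"
    from E[OF this order_refl] \<beta> show "((- 1 / \<beta>) *\<^sub>R a) \<bullet> x + \<gamma> / \<beta> \<le> p x"
      by (simp add: field_simps)
  qed
qed

lemma convex_on_norm_diff: "convex_on UNIV (\<lambda>z. norm (z - x))"
  for x :: "'a::real_normed_vector"
  using convex_on_dist[of UNIV x] by (simp add: dist_norm norm_minus_commute)

text \<open>An affine function above the concave function \<open>- p\<close> and touching it at \<open>x\<close> exists by separation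
  from the constant function on \<open>{x}\<close>; the negative of its slope is a subgradient.\<close>

lemma subgradient_on_UNIV_exists:
  fixes p :: "'a::euclidean_space \<Rightarrow> real"
  assumes "convex_on UNIV p"
  shows "\<exists>v. subgradient_on UNIV p x v"
proof -
  obtain a b where ab: "\<And>z. - p z \<le> a \<bullet> z + b" "\<And>z. z \<in> {x} \<Longrightarrow> a \<bullet> z + b \<le> - p x"
    using affine_between_concave_and_convex[of "{x}" "\<lambda>_. - p x" "\<lambda>z. - p z"] assms
    by (auto simp: concave_on_def convex_on_const)
  have "p x + (- a) \<bullet> (y - x) \<le> p y" for y
    using ab(1)[of y] ab(2)[of x] by (simp add: inner_diff_right)
  then show ?thesis
    unfolding subgradient_on_def by blast
qed

text \<open>The hypothesis says that \<open>x\<close> minimises \<open>p + K * norm (\<cdot> - x)\<close> over \<open>S\<close>. The slope of an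
  affine function between the cone \<open>p x - K * norm (\<cdot> - x)\<close> and \<open>p\<close> is the subgradient sought.\<close>

lemma subgradient_on_of_steepness:
  fixes p :: "'a::euclidean_space \<Rightarrow> real"
  assumes "convex_on S p" "x \<in> S" "K \<ge> 0"
    and "\<And>z. z \<in> S \<Longrightarrow> p x - K * norm (z - x) \<le> p z"
  shows "\<exists>v. subgradient_on S p x v \<and> norm v \<le> K"
proof -
  have "convex_on UNIV (\<lambda>z. K * norm (z - x) + - p x)"
    using assms(3) by (intro convex_on_add convex_on_cmul convex_on_norm_diff) (auto simp: convex_on_const)
  then have "concave_on UNIV (\<lambda>z. p x - K * norm (z - x))"
    by (simp add: concave_on_def algebra_simps)
  then obtain a b where ab: "\<And>z. p x - K * norm (z - x) \<le> a \<bullet> z + b"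
      "\<And>z. z \<in> S \<Longrightarrow> a \<bullet> z + b \<le> p z"
    using affine_between_concave_and_convex[of S p "\<lambda>z. p x - K * norm (z - x)"] assms by auto
  have touch: "a \<bullet> x + b = p x"
    using ab(1)[of x] ab(2)[OF assms(2)] by simp
  have "subgradient_on S p x a"
    unfolding subgradient_on_def
  proof
    fix y assume "y \<in> S"
    from ab(2)[OF this] touch show "p x + a \<bullet> (y - x) \<le> p y"
      by (simp add: inner_diff_right)
  qed
  moreover have "norm a \<le> K"
  proof (cases "a = 0")
    case False
    \<comment> \<open>the affine function falls fastest along \<open>- a\<close>, yet stays above the cone\<close>
    have "norm a * norm a \<le> K * norm a"
      using ab(1)[of "x - a"] touch
      by (simp add: inner_diff_right flip: power2_eq_square dot_square_norm)
    then show ?thesis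
      using False by simp
  qed (use assms in simp)
  ultimately show ?thesis
    by blast
qed

text \<open>The multiplier is the slope of a line separating the attainable pairs of constraint and
  objective values, enlarged upwards in both coordinates, from the pairs that optimality rules out. The Slater point
  keeps this line from being vertical.\<close>

lemma Lagrange_multiplier_exists:
  fixes h g :: "'a::real_vector \<Rightarrow> real"
  assumes h: "convex_on D h" and g: "convex_on D g"
    and x0: "x0 \<in> D" "g x0 < 0"
    and opt: "\<And>x. x \<in> D \<Longrightarrow> g x \<le> 0 \<Longrightarrow> m \<le> h x"
  obtains \<mu> where "\<mu> \<ge> 0" "\<And>x. x \<in> D \<Longrightarrow> m \<le> h x + \<mu> * g x"
proof -
  define P where "P = {(u, w). \<exists>x\<in>D. g x \<le> u \<and> h x \<le> w}"
  define Q where "Q = {(u :: real, w). u \<le> 0 \<and> w < m}"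
  have "convex D"
    using h by (simp add: convex_on_imp_convex)
  have "convex P"
  proof (rule convexI, clarsimp simp: P_def)
    fix x x' u w u' w' and s t :: real
    assume *: "0 \<le> s" "0 \<le> t" "s + t = 1" "x \<in> D" "g x \<le> u" "h x \<le> w"
      "x' \<in> D" "g x' \<le> u'" "h x' \<le> w'"
    have "g (s *\<^sub>R x + t *\<^sub>R x') \<le> s * g x + t * g x'"
      "h (s *\<^sub>R x + t *\<^sub>R x') \<le> s * h x + t * h x'"
      using * g h by (auto simp: convex_on_def)
    moreover have "s * g x + t * g x' \<le> s * u + t * u'" "s * h x + t * h x' \<le> s * w + t * w'"
      using * by (auto intro!: add_mono mult_left_mono)
    moreover have "s *\<^sub>R x + t *\<^sub>R x' \<in> D"
      using * \<open>convex D\<close> by (simp add: convexD)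
    ultimately show "\<exists>y\<in>D. g y \<le> s * u + t * u' \<and> h y \<le> s * w + t * w'"
      by (intro bexI[of _ "s *\<^sub>R x + t *\<^sub>R x'"]) auto
  qed
  moreover have "convex Q"
  proof -
    have "Q = {..0} \<times> {..<m}"
      by (auto simp: Q_def)
    then show ?thesis
      by (simp add: convex_Times)
  qed
  moreover have "P \<noteq> {}"
    using x0 by (auto simp: P_def)
  moreover have "(0, m - 1) \<in> Q"
    by (simp add: Q_def)
  moreover have "P \<inter> Q = {}"
    using opt by (fastforce simp: P_def Q_def)
  ultimately obtain v \<gamma> where v: "v \<noteq> 0" "\<And>z. z \<in> Q \<Longrightarrow> v \<bullet> z \<le> \<gamma>" "\<And>z. z \<in> P \<Longrightarrow> v \<bullet> z \<ge> \<gamma>"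
    using separating_hyperplane_sets[of Q P] by blast
  obtain a b where ab: "v = (a, b)"
    by fastforce
  have Q: "a * u + b * w \<le> \<gamma>" if "u \<le> 0" "w < m" for u w
    using v(2)[of "(u, w)"] that by (simp add: Q_def ab)
  have P: "\<gamma> \<le> a * g x + b * h x" if "x \<in> D" for x
    using v(3)[of "(g x, h x)"] that by (auto simp: P_def ab)
  have "a \<ge> 0"
  proof (rule ccontr)
    assume "\<not> a \<ge> 0"
    \<comment> \<open>far enough to the left in \<open>Q\<close> the functional would exceed \<open>\<gamma>\<close>\<close>
    define u where "u = min 0 ((\<gamma> + 1 - b * (m - 1)) / a)"
    have "a * u \<ge> \<gamma> + 1 - b * (m - 1)"
      using \<open>\<not> a \<ge> 0\<close> unfolding u_def by (auto simp: min_def field_simps)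
    then show False
      using Q[of u "m - 1"] by (simp add: u_def)
  qed
  have "b \<ge> 0"
  proof (rule ccontr)
    assume "\<not> b \<ge> 0"
    \<comment> \<open>far enough down in \<open>Q\<close> the functional would exceed \<open>\<gamma>\<close>\<close>
    define w where "w = min (m - 1) ((\<gamma> + 1) / b)"
    have "b * w \<ge> \<gamma> + 1"
      using \<open>\<not> b \<ge> 0\<close> unfolding w_def by (auto simp: min_def field_simps)
    moreover have "w < m"
      by (auto simp: w_def min_def)
    ultimately show False
      using Q[of 0 w] by simp
  qed
  have \<gamma>: "b * m \<le> \<gamma>"
  proof (cases "b = 0")
    case True
    then show ?thesis
      using Q[of 0 "m - 1"] by simp
  next
    case False
    then have "b > 0"
      using \<open>b \<ge> 0\<close> by simp
    have "m \<le> \<gamma> / b"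
    proof (rule dense_le)
      fix w assume "w < m"
      from Q[OF order_refl this] \<open>b > 0\<close> show "w \<le> \<gamma> / b"
        by (simp add: field_simps)
    qed
    then show ?thesis
      using \<open>b > 0\<close> by (simp add: field_simps)
  qed
  have "b \<noteq> 0"
  proof
    assume "b = 0"
    then have "a > 0"
      using v(1) \<open>a \<ge> 0\<close> by (auto simp: ab zero_prod_def)
    then have "a * g x0 < 0"
      using x0 by (simp add: mult_pos_neg)
    then show False
      using P[OF x0(1)] \<gamma> \<open>b = 0\<close> by simp
  qed
  then have "b > 0"
    using \<open>b \<ge> 0\<close> by simp
  show thesis
  proof (rule that[of "a / b"])
    show "a / b \<ge> 0"
      using \<open>a \<ge> 0\<close> \<open>b > 0\<close> by simp
    show "m \<le> h x + a / b * g x" if "x \<in> D" for x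
    proof -
      have "b * m \<le> b * (h x + a / b * g x)"
        using P[OF that] \<gamma> \<open>b > 0\<close> by (simp add: algebra_simps)
      then show ?thesis
        using \<open>b > 0\<close> by simp
    qed
  qed
qed

section \<open>The KL inequality and growth\<close>

text \<open>Away from minimisers the KL inequality costs nothing: a subgradient at \<open>x\<close> must bridge at
  least the gap \<open>p xbar - p y\<close> over the bounded distance from \<open>x\<close> to \<open>y\<close>, whereas
  \<open>(p x - p xbar) powr \<alpha> \<le> 1\<close> once \<open>p x < p xbar + 1\<close>.\<close>

lemma KL_inequality_of_not_minimiser:
  assumes "y \<in> S" "p y < p xbar" "0 \<le> \<alpha>"
  shows "KL_inequality_on S p xbar \<alpha>"
proof -
  define d where "d = p xbar - p y"
  define R where "R = norm (y - xbar) + 1"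
  have "d > 0" "R > 0"
    using assms by (auto simp: d_def R_def add_nonneg_pos)
  have "d / R * (p x - p xbar) powr \<alpha> \<le> norm v"
    if x: "x \<in> S" "norm (x - xbar) \<le> 1" "p xbar < p x" "p x < p xbar + 1" "subgradient_on S p x v"
    for x v
  proof -
    have "norm (y - x) \<le> R"
      using x(2) norm_triangle_ineq4[of "y - xbar" "x - xbar"] by (simp add: R_def)
    have "p x + v \<bullet> (y - x) \<le> p y"
      using x(5) assms(1) by (simp add: subgradient_on_def)
    moreover have "- (v \<bullet> (y - x)) \<le> norm v * norm (y - x)"
      using Cauchy_Schwarz_ineq2[of v "y - x"] by linarith
    moreover have "norm v * norm (y - x) \<le> norm v * R"
      using \<open>norm (y - x) \<le> R\<close> by (simp add: mult_left_mono)
    ultimately have "d \<le> norm v * R"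
      using x(3) by (simp add: d_def)
    then have "d / R \<le> norm v"
      using \<open>R > 0\<close> by (simp add: field_simps)
    moreover have "(p x - p xbar) powr \<alpha> \<le> 1"
      using x assms(3) by (simp add: powr_le1)
    then have "d / R * (p x - p xbar) powr \<alpha> \<le> d / R"
      using \<open>d > 0\<close> \<open>R > 0\<close> by (intro mult_left_le) auto
    ultimately show ?thesis
      by linarith
  qed
  then show ?thesis
    using \<open>d > 0\<close> \<open>R > 0\<close> by (intro KL_inequality_onI[of "d / R" 1 1]) auto
qed

text \<open>The growth hypothesis bounds a power of \<open>p x - p xbar\<close> from below by the distance to some
  minimiser \<open>y\<close>; the subgradient inequality between \<open>x\<close> and \<open>y\<close> then gives
  \<open>p x - p xbar \<le> norm v * \<kappa> * (p x - p xbar) powr (1 - \<alpha>)\<close>.\<close>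

lemma KL_inequality_of_growth:
  assumes "\<delta> > 0" "\<kappa> > 0"
    and growth: "\<And>x. x \<in> S \<Longrightarrow> norm (x - xbar) \<le> \<delta> \<Longrightarrow> p xbar < p x \<Longrightarrow>
      \<exists>y\<in>S. p y \<le> p xbar \<and> norm (x - y) \<le> \<kappa> * (p x - p xbar) powr (1 - \<alpha>)"
  shows "KL_inequality_on S p xbar \<alpha>"
proof -
  have "1 / \<kappa> * (p x - p xbar) powr \<alpha> \<le> norm v"
    if x: "x \<in> S" "norm (x - xbar) \<le> \<delta>" "p xbar < p x" "subgradient_on S p x v" for x v
  proof -
    define t where "t = p x - p xbar"
    have "t > 0"
      using x by (simp add: t_def)
    obtain y where y: "y \<in> S" "p y \<le> p xbar" "norm (x - y) \<le> \<kappa> * t powr (1 - \<alpha>)"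
      using growth[OF x(1-3)] by (auto simp: t_def)
    have "p x + v \<bullet> (y - x) \<le> p y"
      using x y by (simp add: subgradient_on_def)
    moreover have "- (v \<bullet> (y - x)) \<le> norm v * norm (x - y)"
      using Cauchy_Schwarz_ineq2[of v "y - x"] by (simp add: norm_minus_commute)
    moreover have "norm v * norm (x - y) \<le> norm v * (\<kappa> * t powr (1 - \<alpha>))"
      using y by (intro mult_left_mono) auto
    ultimately have "t \<le> norm v * \<kappa> * t powr (1 - \<alpha>)"
      using y(2) by (simp add: t_def mult.assoc)
    moreover have "t = t powr \<alpha> * t powr (1 - \<alpha>)"
      using \<open>t > 0\<close> by (simp flip: powr_add)
    ultimately have "t powr \<alpha> * t powr (1 - \<alpha>) \<le> (norm v * \<kappa>) * t powr (1 - \<alpha>)"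
      by simp
    then have "t powr \<alpha> \<le> norm v * \<kappa>"
      using \<open>t > 0\<close> by simp
    then show ?thesis
      using \<open>\<kappa> > 0\<close> by (simp add: t_def field_simps)
  qed
  then show ?thesis
    using \<open>\<delta> > 0\<close> \<open>\<kappa> > 0\<close> by (intro KL_inequality_onI[of "1 / \<kappa>" \<delta> 1]) auto
qed

text \<open>A concave power lies below its tangents; multiplied by \<open>t powr \<alpha>\<close>, this is the weighted
  inequality of arithmetic and geometric means.\<close>

lemma powr_le_tangent:
  fixes s t \<alpha> :: real
  assumes "s \<ge> 0" "t > 0" "0 \<le> \<alpha>" "\<alpha> < 1"
  shows "s powr (1 - \<alpha>) \<le> t powr (1 - \<alpha>) + (1 - \<alpha>) * (s - t) / t powr \<alpha>"
proof -
  have "s powr (1 - \<alpha>) * t powr \<alpha> \<le> (1 - \<alpha>) * s + \<alpha> * t"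
  proof (cases "s = 0")
    case False
    then show ?thesis
      using Youngs_inequality_0[of "1 - \<alpha>" \<alpha> s t] assms by simp
  qed (use assms in simp)
  moreover have "t powr (1 - \<alpha>) * t powr \<alpha> = t"
    using assms by (simp flip: powr_add)
  then have "(t powr (1 - \<alpha>) + (1 - \<alpha>) * (s - t) / t powr \<alpha>) * t powr \<alpha> = t + (1 - \<alpha>) * (s - t)"
    using assms by (simp add: distrib_right)
  moreover have "t + (1 - \<alpha>) * (s - t) = (1 - \<alpha>) * s + \<alpha> * t"
    by (simp add: algebra_simps)
  ultimately have "s powr (1 - \<alpha>) * t powr \<alpha>
      \<le> (t powr (1 - \<alpha>) + (1 - \<alpha>) * (s - t) / t powr \<alpha>) * t powr \<alpha>"
    by simp
  then show ?thesis
    using assms by simp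
qed

text \<open>This is Ekeland's variational principle for \<open>\<psi> = (p - p xbar) powr (1 - \<alpha>)\<close>, made
  elementary by compactness. With \<open>k\<close> smaller than the slope \<open>c * (1 - \<alpha>)\<close> that the KL inequality
  guarantees for \<open>\<psi>\<close>, let \<open>y\<close> minimise \<open>\<psi> + k * norm (\<cdot> - x)\<close>. If \<open>p y > p xbar\<close>, then
  minimality and the concavity of the power produce a subgradient of \<open>p\<close> at \<open>y\<close> that is too short
  for the KL inequality. Hence \<open>p y = p xbar\<close>, and comparing the values at \<open>y\<close> and \<open>x\<close> gives
  \<open>k * norm (y - x) \<le> \<psi> x\<close>.\<close>

lemma growth_of_KL_inequality:
  fixes p :: "'a::euclidean_space \<Rightarrow> real"
  assumes "closed D" and cvx: "convex_on D p" and cont: "continuous_on D p"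
    and \<alpha>: "0 \<le> \<alpha>" "\<alpha> < 1"
    and xbar: "xbar \<in> D" and min: "\<And>x. x \<in> D \<Longrightarrow> p xbar \<le> p x"
    and KL: "KL_inequality_on D p xbar \<alpha>"
  obtains \<delta> \<kappa> where "\<delta> > 0" "\<kappa> > 0"
    "\<And>x. x \<in> D \<Longrightarrow> norm (x - xbar) \<le> \<delta> \<Longrightarrow>
       \<exists>y\<in>D. p y = p xbar \<and> norm (x - y) \<le> \<kappa> * (p x - p xbar) powr (1 - \<alpha>)"
proof -
  obtain c \<epsilon> \<nu> where pos: "c > 0" "\<epsilon> > 0" "\<nu> > 0"
    and KL': "\<And>x v. x \<in> D \<Longrightarrow> norm (x - xbar) \<le> \<epsilon> \<Longrightarrow> p xbar < p x \<Longrightarrow> p x < p xbar + \<nu> \<Longrightarrow>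
        subgradient_on D p x v \<Longrightarrow> c * (p x - p xbar) powr \<alpha> \<le> norm v"
    using KL unfolding KL_inequality_on_def by blast
  define k where "k = c * (1 - \<alpha>) / 2"
  have "k > 0"
    using pos \<alpha> by (simp add: k_def)
  define \<psi> where "\<psi> x = (p x - p xbar) powr (1 - \<alpha>)" for x
  have \<psi>_cont: "continuous_on D \<psi>"
    unfolding \<psi>_def using min \<alpha> cont by (intro continuous_on_powr' continuous_intros) auto
  have "\<psi> xbar = 0" "\<And>x. \<psi> x \<ge> 0"
    by (auto simp: \<psi>_def)

  obtain \<delta>1 where \<delta>1: "\<delta>1 > 0" "\<And>x. x \<in> D \<Longrightarrow> dist x xbar < \<delta>1 \<Longrightarrow> dist (p x) (p xbar) < \<nu>"
    using cont xbar pos(3) unfolding continuous_on_iff by metis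
  have "k * \<epsilon> / 2 > 0"
    using \<open>k > 0\<close> pos by simp
  then obtain \<delta>2 where \<delta>2: "\<delta>2 > 0" "\<And>x. x \<in> D \<Longrightarrow> dist x xbar < \<delta>2 \<Longrightarrow> dist (\<psi> x) (\<psi> xbar) < k * \<epsilon> / 2"
    using \<psi>_cont xbar unfolding continuous_on_iff by metis
  define \<delta> where "\<delta> = min (\<epsilon> / 2) (min (\<delta>1 / 2) (\<delta>2 / 2))"
  have "\<delta> > 0"
    using pos \<delta>1 \<delta>2 by (simp add: \<delta>_def)

  have "\<exists>y\<in>D. p y = p xbar \<and> norm (x - y) \<le> 1 / k * \<psi> x"
    if x: "x \<in> D" "norm (x - xbar) \<le> \<delta>" for x
  proof -
    have "dist x xbar < \<delta>1" "dist x xbar < \<delta>2" "norm (x - xbar) \<le> \<epsilon> / 2"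
      using x(2) \<delta>1(1) \<delta>2(1) unfolding \<delta>_def dist_norm by linarith+
    then have px: "p x < p xbar + \<nu>" and \<psi>x: "\<psi> x < k * \<epsilon> / 2"
      using \<delta>1(2)[of x] \<delta>2(2)[of x] x \<open>\<psi> xbar = 0\<close> by (auto simp: dist_real_def)
    define B where "B = D \<inter> cball x (\<epsilon> / 2)"
    have "compact B" "x \<in> B" "B \<subseteq> D"
      using \<open>closed D\<close> x pos by (auto simp: B_def closed_Int_compact)
    moreover have "continuous_on B (\<lambda>z. \<psi> z + k * norm (z - x))"
      using continuous_on_subset[OF \<psi>_cont \<open>B \<subseteq> D\<close>] by (intro continuous_intros)
    ultimately obtain y where y: "y \<in> B"
      "\<And>z. z \<in> B \<Longrightarrow> \<psi> y + k * norm (y - x) \<le> \<psi> z + k * norm (z - x)"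
      using continuous_attains_inf[of B "\<lambda>z. \<psi> z + k * norm (z - x)"] by blast
    have yx: "\<psi> y + k * norm (y - x) \<le> \<psi> x"
      using y(2)[OF \<open>x \<in> B\<close>] by simp
    \<comment> \<open>outside the ball the penalty \<open>k * norm (z - x)\<close> alone exceeds \<open>\<psi> x\<close>\<close>
    have glob: "\<psi> y + k * norm (y - x) \<le> \<psi> z + k * norm (z - x)" if "z \<in> D" for z
    proof (cases "z \<in> B")
      case False
      then have "\<epsilon> / 2 < norm (z - x)"
        using that by (simp add: B_def dist_norm norm_minus_commute)
      then have "k * (\<epsilon> / 2) < k * norm (z - x)"
        using \<open>k > 0\<close> by simp
      then show ?thesis
        using yx \<psi>x \<open>\<psi> z \<ge> 0\<close> by simp
    qed (use y in blast)
    have "y \<in> D" "norm (y - x) \<le> \<epsilon> / 2"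
      using y(1) by (auto simp: B_def dist_norm norm_minus_commute)
    have "norm (y - xbar) \<le> \<epsilon>"
      using norm_triangle_ineq[of "y - x" "x - xbar"] \<open>norm (y - x) \<le> \<epsilon> / 2\<close>
        \<open>norm (x - xbar) \<le> \<epsilon> / 2\<close> by simp
    have "p y = p xbar"
    proof (rule ccontr)
      assume "p y \<noteq> p xbar"
      define t where "t = p y - p xbar"
      have "t > 0"
        using min[OF \<open>y \<in> D\<close>] \<open>p y \<noteq> p xbar\<close> by (simp add: t_def)
      have "\<psi> y \<le> \<psi> x"
        using yx \<open>k > 0\<close> by (smt (verit) mult_nonneg_nonneg norm_ge_zero)
      then have "p y \<le> p x"
        using min[OF \<open>y \<in> D\<close>] min[OF x(1)] \<alpha> powr_less_mono2[of "1 - \<alpha>" "p x - p xbar" "p y - p xbar"]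
        by (fastforce simp: \<psi>_def)
      define K where "K = c / 2 * t powr \<alpha>"
      have "p y - K * norm (z - y) \<le> p z" if "z \<in> D" for z
      proof -
        have "\<psi> y \<le> \<psi> z + k * (norm (z - x) - norm (y - x))"
          using glob[OF that] by (simp add: algebra_simps)
        also have "\<dots> \<le> \<psi> z + k * norm (z - y)"
          using \<open>k > 0\<close> norm_triangle_ineq2[of "z - x" "y - x"] by simp
        also have "\<psi> z \<le> \<psi> y + (1 - \<alpha>) * (p z - p y) / t powr \<alpha>"
          using powr_le_tangent[of "p z - p xbar" t \<alpha>] min[OF that] \<open>t > 0\<close> \<alpha>
          by (simp add: \<psi>_def t_def)
        finally have "0 \<le> (1 - \<alpha>) * (p z - p y) / t powr \<alpha> + k * norm (z - y)"
          by simp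
        then have "0 \<le> ((1 - \<alpha>) * (p z - p y) / t powr \<alpha> + k * norm (z - y)) * (t powr \<alpha> / (1 - \<alpha>))"
          using \<alpha> by (intro mult_nonneg_nonneg) auto
        also have "\<dots> = p z - p y + K * norm (z - y)"
          using \<alpha> \<open>t > 0\<close> by (simp add: k_def K_def field_simps)
        finally show ?thesis
          by simp
      qed
      moreover have "K \<ge> 0"
        using pos by (simp add: K_def)
      ultimately obtain v where v: "subgradient_on D p y v" "norm v \<le> K"
        using subgradient_on_of_steepness[OF cvx \<open>y \<in> D\<close>] by blast
      have "c * t powr \<alpha> \<le> norm v"
        using KL'[OF \<open>y \<in> D\<close> \<open>norm (y - xbar) \<le> \<epsilon>\<close> _ _ v(1)] \<open>p y \<le> p x\<close> px \<open>t > 0\<close>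
        by (simp add: t_def)
      moreover have "c * t powr \<alpha> > 0"
        using pos \<open>t > 0\<close> by simp
      ultimately show False
        using v(2) by (simp add: K_def)
    qed
    moreover have "norm (x - y) \<le> 1 / k * \<psi> x"
      using yx \<open>\<psi> y \<ge> 0\<close> \<open>k > 0\<close> by (simp add: field_simps norm_minus_commute)
    ultimately show ?thesis
      using \<open>y \<in> D\<close> by blast
  qed
  then show thesis
    using that[of \<delta> "1 / k"] \<open>\<delta> > 0\<close> \<open>k > 0\<close> unfolding \<psi>_def by auto
qed

section \<open>Strictly convex compositions\<close>

lemma strictly_convex_on_imp_convex_on:
  assumes "strictly_convex_on S l"
  shows "convex_on S l"
proof (rule convex_onI)
  show "convex S"
    using assms by (simp add: strictly_convex_on_def)
  fix t :: real and x y
  assume *: "0 < t" "t < 1" "x \<in> S" "y \<in> S"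
  show "l ((1 - t) *\<^sub>R x + t *\<^sub>R y) \<le> (1 - t) * l x + t * l y"
  proof (cases "x = y")
    case True
    then show ?thesis
      by (simp flip: scaleR_left_distrib distrib_right)
  next
    case False
    then have "l ((1 - t) *\<^sub>R x + t *\<^sub>R y) < (1 - t) * l x + t * l y"
      using assms[unfolded strictly_convex_on_def, THEN conjunct2, rule_format, of x y "1 - t" t] *
      by simp
    then show ?thesis
      by simp
  qed
qed

lemma convex_on_linear_comp:
  assumes "convex_on UNIV l" "linear T"
  shows "convex_on UNIV (\<lambda>x. l (T x))"
  using assms(1) unfolding convex_on_def linear_add[OF assms(2)] linear_scale[OF assms(2)]
  by blast

text \<open>If two minimisers had different images under \<open>T\<close>, strict convexity of \<open>l\<close> would make the
  value at their midpoint smaller than the minimum.\<close>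

lemma strictly_convex_comp_minimisers:
  assumes l: "strictly_convex_on UNIV l" and "linear T" and q: "convex_on D q"
    and x: "x \<in> D" and y: "y \<in> D" and eq: "l (T y) + q y = l (T x) + q x"
    and min: "\<And>z. z \<in> D \<Longrightarrow> l (T x) + q x \<le> l (T z) + q z"
  shows "T y = T x"
proof (rule ccontr)
  assume "T y \<noteq> T x"
  define z where "z = (1/2) *\<^sub>R x + (1/2) *\<^sub>R y"
  have "z \<in> D"
    unfolding z_def using x y by (intro convexD convex_on_imp_convex[OF q]) auto
  have "l ((1/2) *\<^sub>R T x + (1/2) *\<^sub>R T y) < 1/2 * l (T x) + 1/2 * l (T y)"
    using l[unfolded strictly_convex_on_def, THEN conjunct2, rule_format, of "T x" "T y" "1/2" "1/2"]
      \<open>T y \<noteq> T x\<close> by simp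
  then have "l (T z) < 1/2 * l (T x) + 1/2 * l (T y)"
    using \<open>linear T\<close> by (simp add: z_def linear_add linear_scale)
  moreover have "q z \<le> 1/2 * q x + 1/2 * q y"
    using convex_onD[OF q, of "1/2" x y] x y by (simp add: z_def)
  ultimately show False
    using min[OF \<open>z \<in> D\<close>] eq by linarith
qed

section \<open>The KL exponent of the constrained function\<close>

theorem theorem3p5:
  fixes l :: "real ^ 'm \<Rightarrow> real" and A :: "real ^ 'n ^ 'm"
    and h g :: "real ^ 'n \<Rightarrow> real" and C D :: "(real ^ 'n) set"
    and f :: "real ^ 'n \<Rightarrow> ereal" and \<alpha> :: real
  assumes "continuous_on UNIV l" and "strictly_convex_on UNIV l"
    and h: "\<And>x. h x = l (A *v x)"
    and "continuous_on UNIV g" and "convex_on UNIV g"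
    and "0 < \<alpha>" and "\<alpha> < 1"
    and "closed D" and "convex D"
    and C: "C = {x. g x \<le> 0}"
    and i: "\<exists>x0\<in>D. g x0 < 0"
    and ii: "(INF x\<in>D. ereal (h x)) < (INF x\<in>C \<inter> D. ereal (h x))"
    and iii: "\<And>\<mu>::real. \<mu> > 0 \<Longrightarrow> KL_function (\<lambda>x. ereal (h x + \<mu> * g x) + delta D x) \<alpha>"
    and f: "\<And>x. f x = ereal (h x) + delta C x + delta D x"
  shows "\<forall>xbar \<in> C \<inter> D. KL_property f xbar \<alpha>"
proof
  fix xbar assume xbar: "xbar \<in> C \<inter> D"
  have lin: "linear ((*v) A)"
    by simp
  have h_eq: "h = (\<lambda>x. l (A *v x))"
    using h by (rule ext)
  have h_cont: "continuous_on UNIV h"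
    unfolding h_eq
    by (rule continuous_on_compose2[OF assms(1) matrix_vector_mult_linear_continuous_on]) simp
  have h_cvx: "convex_on UNIV h"
    unfolding h_eq
    by (rule convex_on_linear_comp[OF strictly_convex_on_imp_convex_on[OF assms(2)] lin])
  have f_eq: "f = (\<lambda>x. ereal (h x) + delta (C \<inter> D) x)"
    by (auto simp: f delta_def fun_eq_iff)
  have "closed C"
    unfolding C using assms(4) by (intro closed_Collect_le) auto
  \<comment> \<open>this puts \<open>xbar\<close> in the domain of the subdifferential of \<open>f\<close>\<close>
  obtain v where "subgradient_on UNIV h xbar v"
    using subgradient_on_UNIV_exists[OF h_cvx] by blast
  then have v: "subgradient_on (C \<inter> D) h xbar v"
    by (simp add: subgradient_on_def)

  have "KL_inequality_on (C \<inter> D) h xbar \<alpha>"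
  proof (cases "\<exists>y\<in>C \<inter> D. h y < h xbar")
    case True
    then show ?thesis
      using KL_inequality_of_not_minimiser assms(6) by (metis less_imp_le)
  next
    case False
    then have opt: "\<And>x. x \<in> C \<inter> D \<Longrightarrow> h xbar \<le> h x"
      by force
    obtain x0 where x0: "x0 \<in> D" "g x0 < 0"
      using i by blast
    have cvx_D: "convex_on D h" "convex_on D g"
      using h_cvx assms(5,9) by (auto intro: convex_on_subset)
    obtain \<mu> where \<mu>: "\<mu> \<ge> 0" "\<And>x. x \<in> D \<Longrightarrow> h xbar \<le> h x + \<mu> * g x"
      using Lagrange_multiplier_exists[OF cvx_D x0, of "h xbar"] opt by (auto simp: C)
    have "\<mu> > 0"
    proof (rule ccontr)
      assume "\<not> \<mu> > 0"
      then have "h xbar \<le> h x" if "x \<in> D" for x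
        using \<mu>(2)[OF that] \<mu>(1) by simp
      then have "ereal (h xbar) \<le> (INF x\<in>D. ereal (h x))"
        by (intro INF_greatest) auto
      moreover have "(INF x\<in>C \<inter> D. ereal (h x)) \<le> ereal (h xbar)"
        using xbar by (intro INF_lower)
      ultimately show False
        using ii by simp
    qed
    have "0 \<le> \<mu> * g xbar"
      using \<mu>(2)[of xbar] xbar by simp
    then have g_xbar: "g xbar = 0"
      using xbar \<open>\<mu> > 0\<close> by (simp add: C zero_le_mult_iff)
    define F where "F x = h x + \<mu> * g x" for x
    have F_min: "F xbar \<le> F x" if "x \<in> D" for x
      using \<mu>(2)[OF that] by (simp add: F_def g_xbar)
    have "KL_property (\<lambda>x. ereal (F x) + delta D x) xbar \<alpha>"
    proof -
      have "subgradient_on D F xbar 0"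
        using F_min by (simp add: subgradient_on_def)
      then have "xbar \<in> dom_subdifferential (\<lambda>x. ereal (F x) + delta D x)"
        using xbar by (auto simp: dom_subdifferential_def subdifferential_add_delta)
      then show ?thesis
        using iii[OF \<open>\<mu> > 0\<close>] by (simp add: KL_function_def F_def)
    qed
    then have "KL_inequality_on D F xbar \<alpha>"
      using xbar by (intro KL_inequality_on_of_KL_property) auto
    moreover have "convex_on D F"
      unfolding F_def using cvx_D \<mu>(1) by (intro convex_on_add convex_on_cmul)
    moreover have "continuous_on D F"
      unfolding F_def using h_cont assms(4)
      by (intro continuous_intros) (auto intro: continuous_on_subset)
    ultimately obtain \<delta> \<kappa> where pos: "\<delta> > 0" "\<kappa> > 0"
      and growth: "\<And>x. x \<in> D \<Longrightarrow> norm (x - xbar) \<le> \<delta> \<Longrightarrow>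
         \<exists>y\<in>D. F y = F xbar \<and> norm (x - y) \<le> \<kappa> * (F x - F xbar) powr (1 - \<alpha>)"
      using growth_of_KL_inequality[of D F \<alpha> xbar] F_min xbar assms(6-8)
      by (metis IntD2 less_imp_le)
    have argmin: "y \<in> C \<and> h y = h xbar" if y: "y \<in> D" "F y = F xbar" for y
    proof -
      have "convex_on D (\<lambda>x. \<mu> * g x)"
        using cvx_D \<mu>(1) by (intro convex_on_cmul)
      then have "A *v y = A *v xbar"
        using strictly_convex_comp_minimisers[OF assms(2) lin, of D "\<lambda>x. \<mu> * g x" xbar y]
          y xbar F_min by (simp add: F_def h)
      then show ?thesis
        using y(2) \<open>\<mu> > 0\<close> g_xbar by (simp add: h F_def C)
    qed
    have "\<exists>y\<in>C \<inter> D. h y \<le> h xbar \<and> norm (x - y) \<le> \<kappa> * (h x - h xbar) powr (1 - \<alpha>)"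
      if x: "x \<in> C \<inter> D" "norm (x - xbar) \<le> \<delta>" for x
    proof -
      obtain y where y: "y \<in> D" "F y = F xbar"
        "norm (x - y) \<le> \<kappa> * (F x - F xbar) powr (1 - \<alpha>)"
        using growth[of x] x by blast
      have "\<mu> * g x \<le> 0"
        using x(1) \<mu>(1) by (simp add: C mult_nonneg_nonpos)
      then have "F x - F xbar \<le> h x - h xbar"
        by (simp add: F_def g_xbar)
      then have "\<kappa> * (F x - F xbar) powr (1 - \<alpha>) \<le> \<kappa> * (h x - h xbar) powr (1 - \<alpha>)"
        using pos F_min[of x] x(1) assms(7) by (intro mult_left_mono powr_mono2) auto
      then show ?thesis
        using argmin[OF y(1,2)] y by (intro bexI[of _ y]) auto
    qed
    then show ?thesis
      using pos by (intro KL_inequality_of_growth[of \<delta> \<kappa>]) auto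
  qed
  then show "KL_property f xbar \<alpha>"
    unfolding f_eq using h_cont \<open>closed C\<close> assms(6-8) xbar v
    by (intro KL_property_of_KL_inequality_on) auto
qed

end
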